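(* For every graph $G$ and every 2-switch $\tau$ on $G$, $|\chi(\tau(G))-\chi(G)|\le 1$, where $\chi$ denotes the chromatic number.
   Context: Graphs are finite and simple. A 2-switch on $G$ is specified by four distinct vertices $a,b,c,d$ with $ab,cd\in E(G)$ and $ac,bd\notin E(G)$; it produces $\tau(G)=G-ab-cd+ac+bd$. $\chi(G)$ is the least $k$ such that $G$ admits a proper vertex coloring with $k$ colors. *)

theory Defs
  imports "Graph_Theory.Pair_Digraph"
begin

(* A finite simple graph is a pair_graph: finite, loop-free, and with a symmetric arc set,
   so that the undirected edge uv is represented by the two arcs (u, v) and (v, u). *)

definition is_two_switch :: "'a pair_pre_digraph \<Rightarrow> 'a \<Rightarrow> 'a \<Rightarrow> 'a \<Rightarrow> 'a \<Rightarrow> bool" where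
  "is_two_switch G a b c d \<longleftrightarrow>
     distinct [a, b, c, d] \<and> {a, b, c, d} \<subseteq> pverts G \<and>
     (a, b) \<in> parcs G \<and> (c, d) \<in> parcs G \<and> (a, c) \<notin> parcs G \<and> (b, d) \<notin> parcs G"

definition two_switch :: "'a \<Rightarrow> 'a \<Rightarrow> 'a \<Rightarrow> 'a \<Rightarrow> 'a pair_pre_digraph \<Rightarrow> 'a pair_pre_digraph" where
  "two_switch a b c d G =
     G\<lparr>parcs := parcs G - {(a, b), (b, a), (c, d), (d, c)} \<union> {(a, c), (c, a), (b, d), (d, b)}\<rparr>"

definition proper_coloring :: "'a pair_pre_digraph \<Rightarrow> nat \<Rightarrow> ('a \<Rightarrow> nat) \<Rightarrow> bool" where
  "proper_coloring G k f \<longleftrightarrow>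
     (\<forall>v \<in> pverts G. f v < k) \<and> (\<forall>(u, v) \<in> parcs G. f u \<noteq> f v)"

definition chromatic_number :: "'a pair_pre_digraph \<Rightarrow> nat" where
  "chromatic_number G = (LEAST k. \<exists>f. proper_coloring G k f)"

lemma pair_graph_two_switch:
  assumes "pair_graph G" and "is_two_switch G a b c d"
  shows "pair_graph (two_switch a b c d G)"
proof -
  interpret pair_graph G by fact
  have "sym (parcs G)"
    using pair_sym_arcs by (simp add: symmetric_def)
  then have "sym (parcs (two_switch a b c d G))"
    by (auto simp: two_switch_def sym_def)
  then show ?thesis
    using assms(2) pair_no_loops pair_finite_verts pair_finite_arcs
    by unfold_locales
      (auto simp: two_switch_def is_two_switch_def symmetric_def
        dest: arc_fst_in_verts arc_snd_in_verts)
qed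

(* The set over which the minimum is taken is nonempty, so LEAST is meaningful. *)
lemma proper_coloring_exists:
  assumes "pair_graph G"
  shows "\<exists>k f. proper_coloring G k f"
proof -
  interpret pair_graph G by fact
  obtain f :: "'a \<Rightarrow> nat" and k where f: "f ` pverts G = {i. i < k}" "inj_on f (pverts G)"
    using finite_imp_inj_to_nat_seg[OF pair_finite_verts] by blast
  have "proper_coloring G k f"
    unfolding proper_coloring_def
  proof (intro conjI ballI)
    fix v assume "v \<in> pverts G"
    with f(1) show "f v < k" by blast
  next
    fix e assume e: "e \<in> parcs G"
    obtain u v where uv: "e = (u, v)" by (cases e)
    have "u \<in> pverts G" "v \<in> pverts G" "u \<noteq> v"
      using e uv in_arcsD1 in_arcsD2 pair_no_loops[OF e] by auto
    with f(2) have "f u \<noteq> f v" by (auto dest: inj_onD)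
    with uv show "case e of (u, v) \<Rightarrow> f u \<noteq> f v" by simp
  qed
  then show ?thesis by blast
qed

end

theory Submission
  imports Defs
begin

text \<open>
  A 2-switch deletes the edge \<open>ab\<close>, so \<open>{a, b}\<close> is independent in the new graph and meets
  both new edges \<open>ac\<close> and \<open>bd\<close>. Giving \<open>a\<close> and \<open>b\<close> one fresh color therefore turns a proper
  coloring of the old graph into one of the new graph. The other inequality follows because
  a 2-switch is undone by a 2-switch.
\<close>

lemma proper_coloring_two_switch:
  assumes "pair_graph G" and "is_two_switch G a b c d" and "proper_coloring G k f"
  shows "proper_coloring (two_switch a b c d G) (Suc k) (f(a := k, b := k))"
proof -
  interpret pair_graph G by fact
  have lt: "f v < k" if "v \<in> pverts G" for v
    using assms(3) that by (simp add: proper_coloring_def)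
  have ne: "f u \<noteq> f v" "u \<noteq> v" "f u < k" "f v < k" if "(u, v) \<in> parcs G" for u v
    using assms(3) that pair_no_loops[OF that] lt in_arcsD1[OF that] in_arcsD2[OF that]
    by (auto simp: proper_coloring_def)
  have new: "distinct [a, b, c, d]" "f c < k" "f d < k"
    using assms(2) lt by (auto simp: is_two_switch_def)
  let ?g = "f(a := k, b := k)"
  have "?g u \<noteq> ?g v" if uv: "(u, v) \<in> parcs (two_switch a b c d G)" for u v
  proof (cases "(u, v) \<in> {(a, c), (c, a), (b, d), (d, b)}")
    case True
    \<comment> \<open>Each added edge has exactly one end in \<open>{a, b}\<close>, colored
      \<open>k\<close>; its other end \<open>c\<close> or \<open>d\<close> keeps a color below
      \<open>k\<close>.\<close>
    with new show ?thesis by auto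
  next
    case False
    with uv have "(u, v) \<in> parcs G" "(u, v) \<noteq> (a, b)" "(u, v) \<noteq> (b, a)"
      by (auto simp: two_switch_def)
    \<comment> \<open>With \<open>ab\<close> gone and no loops, at most one end of a surviving edge
      is recolored.\<close>
    with ne[of u v] show ?thesis by auto
  qed
  moreover have "?g v < Suc k" if "v \<in> pverts (two_switch a b c d G)" for v
    using lt[of v] that by (simp add: two_switch_def)
  ultimately show ?thesis
    unfolding proper_coloring_def by blast
qed

lemma chromatic_number_two_switch_le:
  assumes "pair_graph G" and "is_two_switch G a b c d"
  shows "chromatic_number (two_switch a b c d G) \<le> Suc (chromatic_number G)"
proof -
  obtain f where "proper_coloring G (chromatic_number G) f"
    using LeastI_ex[OF proper_coloring_exists[OF assms(1)]]
    unfolding chromatic_number_def by blast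
  from proper_coloring_two_switch[OF assms this] show ?thesis
    unfolding chromatic_number_def[of "two_switch a b c d G"] by (blast intro: Least_le)
qed

text \<open>Exchanging \<open>b\<close> and \<open>c\<close> swaps the deleted pairs
  \<open>ab\<close>, \<open>cd\<close> with the added pairs \<open>ac\<close>,
  \<open>bd\<close>.\<close>

lemma two_switch_reverse:
  assumes "pair_graph G" and "is_two_switch G a b c d"
  shows "is_two_switch (two_switch a b c d G) a c b d"
    and "two_switch a c b d (two_switch a b c d G) = G"
proof -
  interpret pair_graph G by fact
  have sym: "(u, v) \<in> parcs G \<longleftrightarrow> (v, u) \<in> parcs G" for u v
    using pair_sym_arcs by (auto simp: symmetric_def sym_def)
  show "is_two_switch (two_switch a b c d G) a c b d"
    using assms(2) by (auto simp: is_two_switch_def two_switch_def)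
  \<comment> \<open>Edges are pairs of opposite arcs, so recovering \<open>G\<close> exactly needs
    the reversed arcs as well.\<close>
  have "(b, a) \<in> parcs G" "(d, c) \<in> parcs G" "(c, a) \<notin> parcs G" "(d, b) \<notin> parcs G"
    using assms(2) sym by (auto simp: is_two_switch_def)
  then show "two_switch a c b d (two_switch a b c d G) = G"
    using assms(2)
    by (intro pair_pre_digraph.equality) (auto simp: is_two_switch_def two_switch_def)
qed

theorem mainTheorem18:
  fixes G :: "'a pair_pre_digraph" and a b c d :: 'a
  assumes "pair_graph G"
    and "is_two_switch G a b c d"
  shows "\<bar>int (chromatic_number (two_switch a b c d G)) - int (chromatic_number G)\<bar> \<le> 1"
  \<comment> \<open>The second instance applies the bound to the reverse switch.\<close>
  using chromatic_number_two_switch_le[OF assms]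
    chromatic_number_two_switch_le[OF pair_graph_two_switch[OF assms] two_switch_reverse(1)[OF assms]]
  by (simp add: two_switch_reverse(2)[OF assms])

end
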